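(* Let $P=\mathrm{Pol}(\mathbb{Q},\le)$ be the polymorphism clone of $(\mathbb{Q},\le)$. Then $P$ has automatic homeomorphicity: for every countable set $\Omega$ and every closed subclone $P'$ of $\mathcal{O}_\Omega$, every clone isomorphism $\theta\colon P\to P'$ is a homeomorphism.
   Context: For a set $A$, $\mathcal{O}_A$ is the set of all finitary operations $f\colon A^n\to A$, $n\ge 0$. A clone on $A$ is a subset of $\mathcal{O}_A$ closed under composition (whenever arities match) and containing all projections $\pi_i^{(n)}\colon A^n\to A$, $\pi_i^{(n)}(a_1,\dots,a_n)=a_i$ ($1\le i\le n$). For a clone $P$, $P^{(n)}$ is its set of $n$-ary members. $\mathrm{Pol}(\mathbb{Q},\le)$ is the clone of all operations $f\colon\mathbb{Q}^n\to\mathbb{Q}$ ($n\ge0$) such that $a_i\le b_i$ for all $i$ implies $f(a_1,\dots,a_n)\le f(b_1,\dots,b_n)$. A clone homomorphism is an arity-preserving map between clones that sends each projection $\pi_i^{(n)}$ to the projection $\pi_i^{(n)}$ and preserves composition: $\theta(f\circ(g_1,\dots,g_n))=\theta(f)\circ(\theta(g_1),\dots,\theta(g_n))$. A clone isomorphism is a bijective clone homomorphism. The topology on a clone $P$ on $A$ has as sub-basic open sets all sets $\{f\in P^{(n)}\colon f(a_1,\dots,a_n)=b\}$ with $n\ge0$ and $a_1,\dots,a_n,b\in A$. "Closed" means closed in $\mathcal{O}_\Omega$ with this topology. *)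

theory Defs
  imports "HOL-Analysis.Analysis"
begin

definition tuples :: "'a set \<Rightarrow> nat \<Rightarrow> 'a list set" where
  "tuples A n = {as. length as = n \<and> set as \<subseteq> A}"

text \<open>
  A finitary operation is a pair of its arity \<open>n\<close> and a function that is extensional on
  the set of \<open>n\<close>-tuples, so that equality of pairs is equality of operations. The arity has
  to be recorded: on the empty set the operations of different arities have the same graph.
\<close>

type_synonym 'a operation = "nat \<times> ('a list \<Rightarrow> 'a)"

definition all_operations :: "'a set \<Rightarrow> 'a operation set" where
  "all_operations A = (SIGMA n:UNIV. tuples A n \<rightarrow>\<^sub>E A)"

definition n_ary :: "'a operation set \<Rightarrow> nat \<Rightarrow> 'a operation set" where
  "n_ary P n = {f \<in> P. fst f = n}"

text \<open>Positions are counted from \<open>0\<close>, so \<open>i\<close> ranges over \<open>i < n\<close>.\<close>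

definition projection :: "'a set \<Rightarrow> nat \<Rightarrow> nat \<Rightarrow> 'a operation" where
  "projection A n i = (n, \<lambda>as \<in> tuples A n. as ! i)"

text \<open>
  The common arity \<open>n\<close> of the inner operations is an explicit argument, because it is not
  determined by \<open>gs\<close> when the outer operation is nullary and \<open>gs = []\<close>; the composite is then
  the constant \<open>n\<close>-ary operation.
\<close>

definition composition :: "'a set \<Rightarrow> nat \<Rightarrow> 'a operation \<Rightarrow> 'a operation list \<Rightarrow> 'a operation" where
  "composition A n f gs = (n, \<lambda>as \<in> tuples A n. snd f (map (\<lambda>g. snd g as) gs))"

definition is_clone :: "'a set \<Rightarrow> 'a operation set \<Rightarrow> bool" where
  "is_clone A P \<longleftrightarrow>
     P \<subseteq> all_operations A \<and>
     (\<forall>n. \<forall>i<n. projection A n i \<in> P) \<and>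
     (\<forall>k n. \<forall>f \<in> n_ary P k. \<forall>gs \<in> tuples (n_ary P n) k. composition A n f gs \<in> P)"

definition clone_hom ::
  "'a set \<Rightarrow> 'a operation set \<Rightarrow> 'b set \<Rightarrow> 'b operation set \<Rightarrow> ('a operation \<Rightarrow> 'b operation) \<Rightarrow> bool"
  where
  "clone_hom A P B P' \<theta> \<longleftrightarrow>
     (\<forall>n. \<forall>f \<in> n_ary P n. \<theta> f \<in> n_ary P' n) \<and>
     (\<forall>n. \<forall>i<n. \<theta> (projection A n i) = projection B n i) \<and>
     (\<forall>k n. \<forall>f \<in> n_ary P k. \<forall>gs \<in> tuples (n_ary P n) k.
        \<theta> (composition A n f gs) = composition B n (\<theta> f) (map \<theta> gs))"

definition clone_iso ::
  "'a set \<Rightarrow> 'a operation set \<Rightarrow> 'b set \<Rightarrow> 'b operation set \<Rightarrow> ('a operation \<Rightarrow> 'b operation) \<Rightarrow> bool"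
  where
  "clone_iso A P B P' \<theta> \<longleftrightarrow> clone_hom A P B P' \<theta> \<and> bij_betw \<theta> P P'"

text \<open>
  The whole space \<open>P\<close> (the empty intersection of sub-basic sets) is added explicitly, since
  \<^const>\<open>topology_generated_by\<close> takes the union of the generators as the space and for
  \<open>A = {}\<close> this union would be too small.
\<close>

definition clone_topology :: "'a set \<Rightarrow> 'a operation set \<Rightarrow> 'a operation topology" where
  "clone_topology A P =
     topology_generated_by
       (insert P {{f \<in> n_ary P n. snd f as = b} | n as b. as \<in> tuples A n \<and> b \<in> A})"

definition Pol_le :: "'a::order operation set" where
  "Pol_le = {(n, f) \<in> all_operations UNIV.
     \<forall>as \<in> tuples UNIV n. \<forall>bs \<in> tuples UNIV n. (\<forall>i<n. as ! i \<le> bs ! i) \<longrightarrow> f as \<le> f bs}"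

lemma topspace_clone_topology: "topspace (clone_topology A P) = P"
  by (auto simp: clone_topology_def topology_generated_by_topspace n_ary_def)

lemma is_clone_all_operations: "is_clone A (all_operations A)"
  unfolding is_clone_def
proof (intro conjI allI impI ballI)
  fix n i :: nat assume "i < n"
  then show "projection A n i \<in> all_operations A"
    by (auto simp: projection_def all_operations_def tuples_def subset_iff)
next
  fix k n f gs
  assume "f \<in> n_ary (all_operations A) k" "gs \<in> tuples (n_ary (all_operations A) n) k"
  then show "composition A n f gs \<in> all_operations A"
    by (fastforce simp: composition_def all_operations_def n_ary_def tuples_def)
qed simp

lemma is_clone_Pol_le: "is_clone UNIV (Pol_le :: 'a::order operation set)"
  unfolding is_clone_def
proof (intro conjI allI impI ballI)
  show "(Pol_le :: 'a operation set) \<subseteq> all_operations UNIV"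
    by (auto simp: Pol_le_def)
next
  fix n i :: nat assume "i < n"
  then have "projection UNIV n i \<in> (all_operations UNIV :: 'a operation set)"
    using is_clone_all_operations unfolding is_clone_def by blast
  with \<open>i < n\<close> show "projection UNIV n i \<in> (Pol_le :: 'a operation set)"
    by (auto simp: Pol_le_def projection_def)
next
  fix k n and f :: "'a operation" and gs :: "'a operation list"
  assume f: "f \<in> n_ary Pol_le k" and gs: "gs \<in> tuples (n_ary Pol_le n) k"
  have "f \<in> n_ary (all_operations UNIV) k" "gs \<in> tuples (n_ary (all_operations UNIV) n) k"
    using f gs by (auto simp: Pol_le_def n_ary_def tuples_def)
  then have all: "composition UNIV n f gs \<in> all_operations UNIV"
    using is_clone_all_operations unfolding is_clone_def by blast
  have "snd f (map (\<lambda>g. snd g as) gs) \<le> snd f (map (\<lambda>g. snd g bs) gs)"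
    if ab: "as \<in> tuples UNIV n" "bs \<in> tuples UNIV n" "\<forall>i<n. as ! i \<le> bs ! i" for as bs
  proof -
    have "\<forall>i<k. snd (gs ! i) as \<le> snd (gs ! i) bs"
    proof (intro allI impI)
      fix i assume "i < k"
      then have "gs ! i \<in> n_ary Pol_le n"
        using gs by (auto simp: tuples_def)
      then show "snd (gs ! i) as \<le> snd (gs ! i) bs"
        using ab by (auto simp: n_ary_def Pol_le_def)
    qed
    moreover have "length gs = k" using gs by (simp add: tuples_def)
    ultimately show ?thesis
      using f by (auto simp: n_ary_def Pol_le_def tuples_def)
  qed
  with all show "composition UNIV n f gs \<in> Pol_le"
    by (auto simp: Pol_le_def composition_def)
qed

end

theory Submission
  imports Defs
begin

text \<open>
  Nullary operations make \<open>\<theta>\<inverse>\<close> continuous. The isomorphism sends the rational constant \<open>q\<close> of arity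
  \<open>0\<close> to an element \<open>e q\<close> of \<open>\<Omega>\<close>, and \<open>f(a\<^sub>1, \<dots>, a\<^sub>n) = b\<close> holds iff
  \<open>\<theta>(f)(e a\<^sub>1, \<dots>, e a\<^sub>n) = e b\<close> (\<open>apply_eq_iff\<close>). So \<open>\<theta>\<close> maps sub-basic open sets to sub-basic open
  sets.

  For the continuity of \<open>\<theta>\<close>, the key is that every \<open>w \<in> \<Omega>\<close> is fixed by \<open>\<theta>(\<rho>)\<close> for some unary monotone
  \<open>\<rho>\<close> with finite range (\<open>fixed_by_finite_range\<close>). If \<open>\<rho>\<^sub>i\<close> is such a map for \<open>w\<^sub>i\<close>, then
  \<open>\<theta>(f)(w\<^sub>1, \<dots>, w\<^sub>n) = \<theta>(f \<circ> (\<rho>\<^sub>1 \<circ> \<pi>\<^sub>1, \<dots>, \<rho>\<^sub>n \<circ> \<pi>\<^sub>n))(w\<^sub>1, \<dots>, w\<^sub>n)\<close>, and the right-hand side depends only on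
  the values of \<open>f\<close> on the finite set of tuples \<open>(\<rho>\<^sub>1(x\<^sub>1), \<dots>, \<rho>\<^sub>n(x\<^sub>n))\<close>. This is continuity
  (\<open>value_determined_on_finite_set\<close>).

  To find \<open>\<rho>\<close>, call monotone maps \<open>f\<close> and \<open>g\<close> on the rationals equivalent if \<open>\<theta>(f)(w) = \<theta>(g)(w)\<close>. This
  relation is compatible with all monotone operations, applied pointwise, and has only countably many
  classes. Let \<open>r\<close> be real. For each real \<open>t\<close> in \<open>(0, 1)\<close> there is a monotone map that is \<open>0\<close> up to \<open>r\<close>
  and tends to \<open>t\<close> from above as its argument decreases to \<open>r\<close>. There are uncountably many \<open>t\<close>, so two of these maps,
  for some \<open>s < t\<close>, are equivalent. Composing both with a threshold at a rational between \<open>s\<close> and \<open>t\<close>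
  shows that the indicator of \<open>(r, \<infinity>)\<close> is equivalent to the indicator \<open>v\<close> of an up-set inside
  \<open>(r + d, \<infinity>)\<close>, for some \<open>d > 0\<close> (\<open>cut_equiv_later_cut\<close>). Using these two indicators as a switch
  between two given maps, one sees that monotone maps that differ only on \<open>(r, r + d]\<close> are equivalent.
  The same holds to the left of \<open>r\<close> by duality. Hence the identity stays in its class when it is made
  constant on \<open>(r, r + d]\<close> or on \<open>[r - d, r)\<close>. Compactness of a closed interval, in the form of
  Bolzano's bisection, combines finitely many of these collapsing maps into \<open>\<rho>\<close>. To make the ends
  \<open>\<plusminus>\<infinity>\<close> ordinary points of this argument, rationals are measured by their arctangent.
\<close>

section \<open>Congruences with countably many classes on the monotone maps of the rationals\<close>

text \<open>
  The rationals are placed inside a bounded interval, so that neighbourhoods of \<open>\<plusminus>\<infinity>\<close> become one-sided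
  neighbourhoods of real numbers. The arctangent is odd, which makes the duality \<open>x \<mapsto> - x\<close> exact.
\<close>

definition pos :: "rat \<Rightarrow> real" where
  "pos x = arctan (of_rat x)"

lemma pos_le_iff [simp]: "pos x \<le> pos y \<longleftrightarrow> x \<le> y"
  and pos_minus [simp]: "pos (- x) = - pos x"
  by (simp_all add: pos_def of_rat_less_eq arctan_le_iff of_rat_minus arctan_minus)

lemma pos_eq_iff [simp]: "pos x = pos y \<longleftrightarrow> x = y"
  by (metis order.eq_iff pos_le_iff)

text \<open>
  The congruence is given as the kernel of \<open>ev\<close>, whose values serve as names of the classes.
  Compatibility is stated for binary operations \<open>h\<close>. The second argument, usually the point \<open>x\<close> itself,
  lets the first one switch between two maps; if \<open>h\<close> ignores it, \<open>h\<close> acts as a unary map.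
\<close>

locale countable_congruence =
  fixes ev :: "(rat \<Rightarrow> rat) \<Rightarrow> 'b"
  assumes countable_classes: "countable (ev ` {f. mono f})"
    and cong: "\<lbrakk>\<And>a a' b b' :: rat. a \<le> a' \<Longrightarrow> b \<le> b' \<Longrightarrow> (h a b :: rat) \<le> h a' b';
      mono f; mono f'; mono (g :: rat \<Rightarrow> rat); ev f = ev f'\<rbrakk>
      \<Longrightarrow> ev (\<lambda>x. h (f x) (g x)) = ev (\<lambda>x. h (f' x) (g x))"
begin

lemma cong_comp:
  assumes "mono h" "mono f" "mono f'" "ev f = ev f'"
  shows "ev (h \<circ> f) = ev (h \<circ> f')"
  using cong[of "\<lambda>a b. h a" f f' f] assms by (auto simp: comp_def mono_def)

text \<open>
  The maps \<open>F t\<close> below, for real \<open>t\<close> in \<open>(0, 1)\<close>, stay above \<open>t\<close> to the right of \<open>r\<close> and tend to \<open>t\<close>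
  at \<open>r\<close>, as far as there are rationals close to \<open>r\<close>. There are more of them than classes, so two of
  them, for some \<open>s < t\<close>, are equivalent. A threshold at a rational \<open>q\<close> between
  \<open>s\<close> and \<open>t\<close> is passed by \<open>F t\<close> immediately after \<open>r\<close>, but by \<open>F s\<close> only at some distance from \<open>r\<close>.
\<close>

lemma cut_equiv_later_cut:
  fixes r :: real
  obtains d v where "d > 0" "mono v" "\<And>x. pos x \<le> r + d \<Longrightarrow> v x = 0" "\<And>x. v x = 0 \<or> v x = 1"
    "ev v = ev (\<lambda>x. if pos x > r then 1 else 0)"
proof -
  \<comment> \<open>Approximations of \<open>t\<close> from above by rationals: as \<open>x\<close> approaches \<open>r\<close>, more and more rationals,
    in the order of an enumeration, compete for being the least one above \<open>t\<close>. This way \<open>F t\<close> is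
    monotone without any choice, and every rational above \<open>t\<close> is eventually an upper bound of it.\<close>
  define C where "C t x = insert 1 {q. t < of_rat q \<and> real (to_nat q) * (pos x - r) \<le> 1}"
    for t :: real and x :: rat
  define F where "F t x = (if pos x \<le> r then 0 else Min (C t x))" for t x
  have fin: "finite (C t x)" if "pos x > r" for t x
  proof -
    obtain N where N: "1 / (pos x - r) \<le> real N" using real_arch_simple by blast
    have "to_nat q \<le> N" if "real (to_nat q) * (pos x - r) \<le> 1" for q :: rat
    proof -
      have "real (to_nat q) \<le> 1 / (pos x - r)"
        using that \<open>pos x > r\<close> by (simp add: field_simps)
      with N show ?thesis by linarith
    qed
    then have "C t x \<subseteq> insert 1 (to_nat -` {..N})" by (auto simp: C_def)
    moreover have "finite ((to_nat :: rat \<Rightarrow> nat) -` {..N})" by (intro finite_vimageI) auto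
    ultimately show ?thesis by (meson finite.insertI finite_subset)
  qed
  have F_gt: "t < of_rat (F t x)" if "pos x > r" "t < 1" for t x
  proof -
    have "Min (C t x) \<in> C t x" using fin[OF that(1)] by (intro Min_in) (auto simp: C_def)
    then show ?thesis using that by (auto simp: F_def C_def)
  qed
  have F_mono: "mono (F t)" if "0 < t" "t < 1" for t
  proof (rule monoI)
    fix x y :: rat assume xy: "x \<le> y"
    show "F t x \<le> F t y"
    proof (cases "pos x > r")
      case True
      then have y: "pos y > r" using xy pos_le_iff[of x y] by linarith
      have "C t y \<subseteq> C t x"
      proof -
        have "real (to_nat q) * (pos x - r) \<le> 1" if "real (to_nat q) * (pos y - r) \<le> 1" for q :: rat
        proof -
          have "real (to_nat q) * (pos x - r) \<le> real (to_nat q) * (pos y - r)"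
            using xy by (intro mult_left_mono) auto
          with that show ?thesis by linarith
        qed
        then show ?thesis by (auto simp: C_def)
      qed
      then have "Min (C t x) \<le> Min (C t y)"
        using fin[OF True] by (intro Min_antimono) (auto simp: C_def)
      then show ?thesis using True y by (simp add: F_def)
    next
      case False
      then have "F t x = 0" by (simp add: F_def)
      moreover have "0 \<le> F t y"
      proof (cases "pos y > r")
        case True
        then have "0 < (of_rat (F t y) :: real)" using F_gt[of y t] that by linarith
        then show ?thesis by simp
      qed (simp add: F_def)
      ultimately show ?thesis by simp
    qed
  qed
  have "\<not> inj_on (\<lambda>t. ev (F t)) {0<..<1}"
  proof
    assume "inj_on (\<lambda>t. ev (F t)) {0<..<1}"
    moreover have "countable ((\<lambda>t. ev (F t)) ` {0<..<1})"
      by (rule countable_subset[OF _ countable_classes]) (auto intro!: imageI F_mono)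
    ultimately have "countable {0<..<1::real}" by (rule countable_image_inj_on[rotated])
    then show False using uncountable_open_interval[of 0 1] by simp
  qed
  then obtain s t where st: "0 < s" "s < t" "t < 1" "ev (F s) = ev (F t)"
    unfolding inj_on_def by (metis greaterThanLessThan_iff linorder_neqE_linordered_idom)
  obtain q where q: "s < of_rat q" "of_rat q < t" using of_rat_dense[OF st(2)] by blast
  define h :: "rat \<Rightarrow> rat" where "h y = (if y > q then 1 else 0)" for y
  have h: "mono h" by (auto simp: h_def mono_def)
  \<comment> \<open>Within distance \<open>d\<close> of \<open>r\<close>, the rational \<open>q\<close> itself is a candidate, hence \<open>F s\<close> does not exceed it.\<close>
  define d where "d = 1 / (real (to_nat q) + 1)"
  have "d > 0" by (simp add: d_def)
  have q0: "0 < q" using q(1) st(1) by (metis less_trans zero_less_of_rat_iff)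
  show thesis
  proof (rule that)
    show "d > 0" by fact
    show "mono (h \<circ> F s)" using h F_mono[of s] st by (auto simp: mono_def)
    show "(h \<circ> F s) x = 0 \<or> (h \<circ> F s) x = 1" for x by (simp add: h_def)
    show "(h \<circ> F s) x = 0" if "pos x \<le> r + d" for x
    proof (cases "pos x \<le> r")
      case True
      then show ?thesis using q0 by (simp add: h_def F_def)
    next
      case False
      have "real (to_nat q) * (pos x - r) \<le> real (to_nat q) * d"
        using that by (intro mult_left_mono) auto
      also have "\<dots> \<le> 1" by (simp add: d_def field_simps)
      finally have "q \<in> C s x" using q by (simp add: C_def)
      then have "Min (C s x) \<le> q" using fin False by simp
      then show ?thesis using False by (simp add: h_def F_def)
    qed
    have "h \<circ> F t = (\<lambda>x. if pos x > r then 1 else 0)"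
    proof
      fix x
      show "(h \<circ> F t) x = (if pos x > r then 1 else 0)"
      proof (cases "pos x > r")
        case True
        have "of_rat q < (of_rat (F t x) :: real)" using F_gt[OF True] st q by (meson less_trans)
        then show ?thesis using True by (simp add: h_def of_rat_less)
      next
        case False
        then show ?thesis using q0 by (simp add: F_def h_def)
      qed
    qed
    then show "ev (h \<circ> F s) = ev (\<lambda>x. if pos x > r then 1 else 0)"
      using cong_comp[OF h F_mono F_mono st(4)] st by simp
  qed
qed

text \<open>
  The equivalent indicators of the previous lemma serve as a switch between \<open>f\<close> and \<open>max f g\<close>. They
  differ only on a set that contains \<open>(r, r + d]\<close>, and outside of \<open>(r, r + d]\<close> the position of the switch
  does not matter. The detour through \<open>max f g\<close> makes the switch monotone, since \<open>f\<close> and \<open>g\<close>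
  need not be comparable.
\<close>

lemma equiv_if_differ_right_of:
  fixes r :: real
  obtains d where "d > 0"
    "\<And>f g. mono f \<Longrightarrow> mono g \<Longrightarrow> (\<And>x. pos x \<le> r \<or> r + d < pos x \<Longrightarrow> f x = g x) \<Longrightarrow> ev f = ev g"
proof -
  obtain d v where d: "d > 0" and v: "mono v" "\<And>x. pos x \<le> r + d \<Longrightarrow> v x = 0"
    "\<And>x. v x = 0 \<or> v x = 1" and ev: "ev v = ev (\<lambda>x. if pos x > r then 1 else 0)"
    using cut_equiv_later_cut[of r] by metis
  have max: "ev (\<lambda>x. max (f x) (g x)) = ev f"
    if f: "mono f" and g: "mono g" and eq: "\<And>x. pos x \<le> r \<or> r + d < pos x \<Longrightarrow> f x = g x" for f g
  proof -
    define h where "h b x = (if b \<ge> 1 then max (f x) (g x) else f x)" for b x :: rat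
    have "ev (\<lambda>x. h (v x) x) = ev (\<lambda>x. h (if pos x > r then 1 else 0) x)"
    proof (rule cong[of h v "\<lambda>x. if pos x > r then 1 else 0" "\<lambda>x. x"])
      show "h a b \<le> h a' b'" if "a \<le> a'" "b \<le> b'" for a a' b b'
        using monoD[OF f that(2)] monoD[OF g that(2)] that(1) by (auto simp: h_def)
      show "mono (\<lambda>x. if pos x > r then 1 else 0 :: rat)"
      proof (rule monoI)
        fix x y :: rat assume "x \<le> y"
        then have "pos x \<le> pos y" by simp
        then show "(if pos x > r then 1 else 0 :: rat) \<le> (if pos y > r then 1 else 0)"
          by (auto simp del: pos_le_iff)
      qed
    qed (use v ev in \<open>auto simp: mono_def\<close>)
    moreover have "h (v x) x = f x" for x
      using v(2)[of x] eq[of x] by (cases "pos x \<le> r + d") (auto simp: h_def)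
    moreover have "h (if pos x > r then 1 else 0) x = max (f x) (g x)" for x
      using eq[of x] by (auto simp: h_def)
    ultimately show ?thesis by simp
  qed
  have "ev f = ev g"
    if "mono f" "mono g" "\<And>x. pos x \<le> r \<or> r + d < pos x \<Longrightarrow> f x = g x" for f g
    using max[of f g] max[of g f] that by (simp add: max.commute)
  with d that show thesis by blast
qed

text \<open>
  Conjugating monotone maps by \<open>x \<mapsto> - x\<close> turns left neighbourhoods into right ones, so statements about
  the left of \<open>r\<close> are those about the right of \<open>- r\<close> for the conjugated congruence.
\<close>

lemma dual: "countable_congruence (\<lambda>f. ev (\<lambda>x. - f (- x)))"
proof
  have "(\<lambda>f. ev (\<lambda>x. - f (- x))) ` {f. mono f} \<subseteq> ev ` {f. mono f}"
    by (auto simp: mono_def intro!: imageI)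
  then show "countable ((\<lambda>f. ev (\<lambda>x. - f (- x))) ` {f. mono f})"
    using countable_classes countable_subset by blast
next
  fix h :: "rat \<Rightarrow> rat \<Rightarrow> rat" and f f' g :: "rat \<Rightarrow> rat"
  assume "\<And>a a' b b'. a \<le> a' \<Longrightarrow> b \<le> b' \<Longrightarrow> h a b \<le> h a' b'" "mono f" "mono f'" "mono g"
    "ev (\<lambda>x. - f (- x)) = ev (\<lambda>x. - f' (- x))"
  then show "ev (\<lambda>x. - h (f (- x)) (g (- x))) = ev (\<lambda>x. - h (f' (- x)) (g (- x)))"
    using cong[of "\<lambda>a b. - h (- a) (- b)" "\<lambda>x. - f (- x)" "\<lambda>x. - f' (- x)" "\<lambda>x. - g (- x)"]
    by (simp add: mono_def)
qed

lemma equiv_if_differ_left_of: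
  fixes r :: real
  obtains d where "d > 0"
    "\<And>f g. mono f \<Longrightarrow> mono g \<Longrightarrow> (\<And>x. pos x < r - d \<or> r \<le> pos x \<Longrightarrow> f x = g x) \<Longrightarrow> ev f = ev g"
proof -
  interpret dual: countable_congruence "\<lambda>f. ev (\<lambda>x. - f (- x))" by (rule dual)
  obtain d where d: "d > 0" and
    *: "\<And>f g. mono f \<Longrightarrow> mono g \<Longrightarrow> (\<And>x. pos x \<le> - r \<or> - r + d < pos x \<Longrightarrow> f x = g x) \<Longrightarrow>
      ev (\<lambda>x. - f (- x)) = ev (\<lambda>x. - g (- x))"
    using dual.equiv_if_differ_right_of[of "- r"] by metis
  have "ev f = ev g"
    if fg: "mono f" "mono g" and eq: "\<And>x. pos x < r - d \<or> r \<le> pos x \<Longrightarrow> f x = g x" for f g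
  proof -
    have "ev (\<lambda>x. - (\<lambda>x. - f (- x)) (- x)) = ev (\<lambda>x. - (\<lambda>x. - g (- x)) (- x))"
    proof (rule *)
      show "- f (- x) = - g (- x)" if "pos x \<le> - r \<or> - r + d < pos x" for x
        using that eq[of "- x"] by auto
    qed (use fg in \<open>auto simp: mono_def\<close>)
    then show ?thesis by simp
  qed
  with d that show thesis by blast
qed

text \<open>
  The condition that the collapsing map is the identity outside of the interval is what makes
  collapsing maps of adjacent intervals compose.
\<close>

definition collapsible :: "real \<Rightarrow> real \<Rightarrow> bool" where
  "collapsible a b \<longleftrightarrow> (\<exists>f. mono f \<and> ev f = ev id \<and> finite (f ` {x. a \<le> pos x \<and> pos x \<le> b}) \<and>
     (\<forall>x. pos x < a \<or> b < pos x \<longrightarrow> f x = x))"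

lemma collapsible_trans:
  assumes "collapsible a b" "collapsible b c" "a \<le> b" "b \<le> c"
  shows "collapsible a c"
proof -
  obtain f where f: "mono f" "ev f = ev id" "finite (f ` {x. a \<le> pos x \<and> pos x \<le> b})"
    "\<And>x. pos x < a \<or> b < pos x \<Longrightarrow> f x = x"
    using assms(1) by (auto simp: collapsible_def)
  obtain g where g: "mono g" "ev g = ev id" "finite (g ` {x. b \<le> pos x \<and> pos x \<le> c})"
    "\<And>x. pos x < b \<or> c < pos x \<Longrightarrow> g x = x"
    using assms(2) by (auto simp: collapsible_def)
  have "ev (f \<circ> g) = ev (f \<circ> id)"
    using f g by (intro cong_comp) (auto simp: mono_def)
  moreover have "(f \<circ> g) ` {x. a \<le> pos x \<and> pos x \<le> c}
      \<subseteq> f ` (g ` {x. b \<le> pos x \<and> pos x \<le> c}) \<union> f ` {x. a \<le> pos x \<and> pos x \<le> b}"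
  proof clarify
    fix x assume x: "a \<le> pos x" "pos x \<le> c" "(f \<circ> g) x \<notin> f ` {x. a \<le> pos x \<and> pos x \<le> b}"
    show "(f \<circ> g) x \<in> f ` g ` {x. b \<le> pos x \<and> pos x \<le> c}"
      using x g(4)[of x] by (cases "pos x < b") auto
  qed
  then have "finite ((f \<circ> g) ` {x. a \<le> pos x \<and> pos x \<le> c})"
    using f(3) g(3) by (meson finite_UnI finite_imageI finite_subset)
  moreover have "mono (f \<circ> g)" using f(1) g(1) by (auto simp: mono_def)
  moreover have "(f \<circ> g) x = x" if "pos x < a \<or> c < pos x" for x
    using that f(4)[of x] g(4)[of x] assms by auto
  ultimately show ?thesis
    unfolding collapsible_def using f(2) by (intro exI[of _ "f \<circ> g"]) auto
qed

text \<open>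
  Both half-open intervals next to \<open>r\<close> can be collapsed to one of their points; \<open>r\<close> itself is left in
  place, because the cuts just before and just after a rational are in general not equivalent.
\<close>

lemma collapsible_locally:
  obtains d where "d > 0" "\<And>a b. a \<le> r \<Longrightarrow> r \<le> b \<Longrightarrow> b - a < d \<Longrightarrow> collapsible a b"
proof -
  obtain d1 where d1: "d1 > 0" and right: "\<And>f g. mono f \<Longrightarrow> mono g \<Longrightarrow>
      (\<And>x. pos x \<le> r \<or> r + d1 < pos x \<Longrightarrow> f x = g x) \<Longrightarrow> ev f = ev g"
    using equiv_if_differ_right_of[of r] by metis
  obtain d2 where d2: "d2 > 0" and left: "\<And>f g. mono f \<Longrightarrow> mono g \<Longrightarrow>
      (\<And>x. pos x < r - d2 \<or> r \<le> pos x \<Longrightarrow> f x = g x) \<Longrightarrow> ev f = ev g"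
    using equiv_if_differ_left_of[of r] by metis
  have mono_collapse: "mono (\<lambda>x. if x \<in> J then p else x)"
    if p: "p \<in> J" and convex: "\<And>x y z. x \<in> J \<Longrightarrow> z \<in> J \<Longrightarrow> x \<le> y \<Longrightarrow> y \<le> z \<Longrightarrow> y \<in> J"
    for J and p :: rat
  proof (rule monoI)
    fix x y :: rat assume xy: "x \<le> y"
    have "p \<le> y" if "x \<in> J" "y \<notin> J" using that p convex[of x p y] xy by force
    moreover have "x \<le> p" if "x \<notin> J" "y \<in> J" using that p convex[of p y x] xy by force
    ultimately show "(if x \<in> J then p else x) \<le> (if y \<in> J then p else y)" using xy by simp
  qed
  have finite_r: "finite {x. pos x = r}"
    by (rule finite_subset[of _ "{inv pos r}"]) (auto simp: inv_f_f inj_def)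
  have collapsible: "collapsible a b" if "a \<le> r" "r \<le> b" "b - a < min d1 d2" for a b
  proof -
    define J1 where "J1 = {x. r < pos x \<and> pos x \<le> b}"
    define J2 where "J2 = {x. a \<le> pos x \<and> pos x < r}"
    \<comment> \<open>Either interval may contain no rational at all; then its collapsing map is the identity.\<close>
    define f where "f J x = (if x \<in> J then SOME p. p \<in> J else x)" for J and x :: rat
    have mono_f: "mono (f J)"
      if "\<And>x y z. x \<in> J \<Longrightarrow> z \<in> J \<Longrightarrow> x \<le> y \<Longrightarrow> y \<le> z \<Longrightarrow> y \<in> J" for J
    proof (cases "J = {}")
      case True
      then show ?thesis by (simp add: f_def mono_def)
    next
      case False
      then have "(SOME p. p \<in> J) \<in> J" by (simp add: some_in_eq)
      from mono_collapse[OF this that] show ?thesis by (simp add: f_def[abs_def])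
    qed
    have convex1: "y \<in> J1" if "x \<in> J1" "z \<in> J1" "x \<le> y" "y \<le> z" for x y z
    proof -
      have "pos x \<le> pos y" "pos y \<le> pos z" using that by simp_all
      then show ?thesis using that(1,2) by (simp add: J1_def del: pos_le_iff)
    qed
    have convex2: "y \<in> J2" if "x \<in> J2" "z \<in> J2" "x \<le> y" "y \<le> z" for x y z
    proof -
      have "pos x \<le> pos y" "pos y \<le> pos z" using that by simp_all
      then show ?thesis using that(1,2) by (simp add: J2_def del: pos_le_iff)
    qed
    have m1: "mono (f J1)" by (rule mono_f) (rule convex1)
    have m2: "mono (f J2)" by (rule mono_f) (rule convex2)
    have "f J1 ` {x. r \<le> pos x \<and> pos x \<le> b} \<subseteq> insert (SOME p. p \<in> J1) {x. pos x = r}"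
      by (auto simp: f_def J1_def)
    then have "finite (f J1 ` {x. r \<le> pos x \<and> pos x \<le> b})"
      using finite_r by (meson finite.insertI finite_subset)
    moreover have "ev (f J1) = ev id"
      using m1 that by (intro right) (auto simp: f_def J1_def mono_def)
    ultimately have "collapsible r b"
      unfolding collapsible_def using m1 by (intro exI[of _ "f J1"]) (auto simp: f_def J1_def)
    have "f J2 ` {x. a \<le> pos x \<and> pos x \<le> r} \<subseteq> insert (SOME p. p \<in> J2) {x. pos x = r}"
      by (auto simp: f_def J2_def)
    then have "finite (f J2 ` {x. a \<le> pos x \<and> pos x \<le> r})"
      using finite_r by (meson finite.insertI finite_subset)
    moreover have "ev (f J2) = ev id"
      using m2 that by (intro left) (auto simp: f_def J2_def mono_def)
    ultimately have "collapsible a r"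
      unfolding collapsible_def using m2 by (intro exI[of _ "f J2"]) (auto simp: f_def J2_def)
    with \<open>collapsible r b\<close> show ?thesis using collapsible_trans that by blast
  qed
  show thesis
    using that[of "min d1 d2"] d1 d2 collapsible by auto
qed

lemma id_equiv_finite_range:
  obtains f where "mono f" "finite (range f)" "ev f = ev id"
proof -
  have "collapsible (- 2) 2"
  proof (rule Bolzano)
    show "\<exists>d>0. \<forall>a b. a \<le> x \<and> x \<le> b \<and> b - a < d \<longrightarrow> collapsible a b" for x
      using collapsible_locally[of x] by metis
  qed (auto intro: collapsible_trans)
  moreover have "- 2 \<le> pos x \<and> pos x \<le> 2" for x
    using arctan_bounded[of "of_rat x"] pi_less_4 unfolding pos_def by linarith
  ultimately show thesis using that by (auto simp: collapsible_def)
qed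

end

section \<open>Operations, clones and the topology\<close>

definition unary :: "('a \<Rightarrow> 'a) \<Rightarrow> 'a operation" where
  "unary f = (1, \<lambda>as \<in> tuples UNIV 1. f (as ! 0))"

definition binary :: "('a \<Rightarrow> 'a \<Rightarrow> 'a) \<Rightarrow> 'a operation" where
  "binary h = (2, \<lambda>as \<in> tuples UNIV 2. h (as ! 0) (as ! 1))"

definition nullary :: "'a \<Rightarrow> 'a operation" where
  "nullary q = (0, \<lambda>as \<in> tuples UNIV 0. q)"

lemma unary_in_Pol_le: "mono f \<Longrightarrow> unary f \<in> n_ary Pol_le 1"
  by (auto simp: unary_def n_ary_def Pol_le_def all_operations_def tuples_def mono_def)

lemma binary_in_Pol_le:
  "(\<And>a a' b b'. a \<le> a' \<Longrightarrow> b \<le> b' \<Longrightarrow> h a b \<le> h a' b') \<Longrightarrow> binary h \<in> n_ary Pol_le 2"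
  by (auto simp: binary_def n_ary_def Pol_le_def all_operations_def tuples_def)

lemma nullary_in_Pol_le: "nullary q \<in> n_ary Pol_le 0"
  by (auto simp: nullary_def n_ary_def Pol_le_def all_operations_def tuples_def)

lemma projection_in_n_ary:
  assumes "is_clone A P" "i < n"
  shows "projection A n i \<in> n_ary P n"
  using assms by (simp add: is_clone_def n_ary_def projection_def)

lemma composition_in_n_ary:
  assumes "is_clone A P" "f \<in> n_ary P k" "gs \<in> tuples (n_ary P n) k"
  shows "composition A n f gs \<in> n_ary P n"
proof -
  have "composition A n f gs \<in> P" using assms by (simp add: is_clone_def)
  then show ?thesis by (simp add: n_ary_def composition_def)
qed

lemma n_ary_apply_closed:
  assumes "is_clone A P" "f \<in> n_ary P n" "as \<in> tuples A n"
  shows "snd f as \<in> A"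
  using assms by (fastforce simp: is_clone_def all_operations_def n_ary_def)

lemma clone_hom_composition_apply:
  assumes "clone_hom A P B P' \<theta>" "f \<in> n_ary P k" "gs \<in> tuples (n_ary P n) k" "bs \<in> tuples B n"
  shows "snd (\<theta> (composition A n f gs)) bs = snd (\<theta> f) (map (\<lambda>g. snd (\<theta> g) bs) gs)"
  using assms by (simp add: clone_hom_def composition_def comp_def)

lemma openin_clone_topology_basic:
  assumes "as \<in> tuples A n" "b \<in> A"
  shows "openin (clone_topology A P) {f \<in> n_ary P n. snd f as = b}"
  unfolding clone_topology_def using assms by (intro topology_generated_by_Basis) blast

lemma continuous_map_into_clone_topology:
  assumes "\<And>x. x \<in> topspace X \<Longrightarrow> h x \<in> P"
    and "\<And>n as b. as \<in> tuples A n \<Longrightarrow> b \<in> A \<Longrightarrow>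
      openin X {x \<in> topspace X. h x \<in> n_ary P n \<and> snd (h x) as = b}"
  shows "continuous_map X (clone_topology A P) h"
  unfolding clone_topology_def
proof (rule continuous_on_generated_topo)
  fix U assume "U \<in> insert P {{f \<in> n_ary P n. snd f as = b} | n as b. as \<in> tuples A n \<and> b \<in> A}"
  then consider "U = P" | n as b where "U = {f \<in> n_ary P n. snd f as = b}" "as \<in> tuples A n" "b \<in> A"
    by blast
  then show "openin X (h -` U \<inter> topspace X)"
  proof cases
    case 1
    then have "h -` U \<inter> topspace X = topspace X" using assms(1) by auto
    then show ?thesis by simp
  next
    case 2
    then have "h -` U \<inter> topspace X = {x \<in> topspace X. h x \<in> n_ary P n \<and> snd (h x) as = b}" by auto
    then show ?thesis using assms(2) 2 by simp
  qed
qed (use assms(1) in auto)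

section \<open>Isomorphisms onto clones on countable sets\<close>

context
  fixes \<Omega> :: "'b set" and P' :: "'b operation set" and \<theta> :: "rat operation \<Rightarrow> 'b operation"
  assumes countable: "countable \<Omega>"
    and clone: "is_clone \<Omega> P'"
    and iso: "clone_iso UNIV (Pol_le :: rat operation set) \<Omega> P' \<theta>"
begin

lemma hom: "clone_hom UNIV (Pol_le :: rat operation set) \<Omega> P' \<theta>"
  using iso by (simp add: clone_iso_def)

lemma hom_n_ary: "f \<in> n_ary Pol_le n \<Longrightarrow> \<theta> f \<in> n_ary P' n"
  using hom by (simp add: clone_hom_def)

text \<open>
  \<open>\<theta>\<close> turns pointwise application of \<open>h\<close> into application of \<open>\<theta>(h)\<close> to the values at \<open>w\<close>, hence agreement
  at \<open>w\<close> is a congruence; its classes correspond to elements of \<open>\<Omega>\<close>.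
\<close>

lemma countable_congruence_at:
  assumes "w \<in> \<Omega>"
  shows "countable_congruence (\<lambda>f. snd (\<theta> (unary f)) [w])"
proof
  have w: "[w] \<in> tuples \<Omega> 1" using assms by (simp add: tuples_def)
  have "(\<lambda>f. snd (\<theta> (unary f)) [w]) ` {f. mono f} \<subseteq> \<Omega>"
    using n_ary_apply_closed[OF clone hom_n_ary[OF unary_in_Pol_le] w] by auto
  then show "countable ((\<lambda>f. snd (\<theta> (unary f)) [w]) ` {f. mono f})"
    using countable countable_subset by blast
  fix h :: "rat \<Rightarrow> rat \<Rightarrow> rat" and f f' g :: "rat \<Rightarrow> rat"
  assume h: "\<And>a a' b b'. a \<le> a' \<Longrightarrow> b \<le> b' \<Longrightarrow> h a b \<le> h a' b'"
    and mono: "mono f" "mono f'" "mono g"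
    and eq: "snd (\<theta> (unary f)) [w] = snd (\<theta> (unary f')) [w]"
  have "snd (\<theta> (unary (\<lambda>x. h (f x) (g x)))) [w]
      = snd (\<theta> (binary h)) [snd (\<theta> (unary f)) [w], snd (\<theta> (unary g)) [w]]"
    if f: "mono f" for f
  proof -
    have "unary (\<lambda>x. h (f x) (g x)) = composition UNIV 1 (binary h) [unary f, unary g]"
      by (auto simp: unary_def binary_def composition_def tuples_def fun_eq_iff)
    moreover have "[unary f, unary g] \<in> tuples (n_ary Pol_le 1) 2"
      using unary_in_Pol_le f mono by (auto simp: tuples_def)
    ultimately show ?thesis
      using clone_hom_composition_apply[OF hom binary_in_Pol_le[of h] _ w] h by simp
  qed
  from this[OF mono(1)] this[OF mono(2)] eq
  show "snd (\<theta> (unary (\<lambda>x. h (f x) (g x)))) [w] = snd (\<theta> (unary (\<lambda>x. h (f' x) (g x)))) [w]"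
    by simp
qed

lemma fixed_by_finite_range:
  assumes "w \<in> \<Omega>"
  obtains \<rho> :: "rat \<Rightarrow> rat"
  where "mono \<rho>" "finite (range \<rho>)" "snd (\<theta> (unary \<rho>)) [w] = w"
proof -
  have "unary (id :: rat \<Rightarrow> rat) = projection UNIV 1 0"
    by (auto simp: unary_def projection_def fun_eq_iff)
  moreover have "\<theta> (projection UNIV 1 0) = projection \<Omega> 1 0"
    using hom unfolding clone_hom_def by (metis zero_less_one)
  ultimately have "\<theta> (unary id) = projection \<Omega> 1 0" by simp
  then have "snd (\<theta> (unary id)) [w] = w"
    using assms by (simp add: projection_def tuples_def)
  then show thesis
    using countable_congruence.id_equiv_finite_range[OF countable_congruence_at[OF assms]] that
    by metis
qed

text \<open>
  Here the finite set is the set of tuples that the maps \<open>\<rho> (ws ! i)\<close> produce. Since \<open>ws\<close> is fixed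
  coordinatewise by the images of these maps under \<open>\<theta>\<close>, they can be inserted into the arguments of \<open>f\<close> without changing the value at \<open>ws\<close>.
\<close>

lemma value_determined_on_finite_set:
  assumes ws: "ws \<in> tuples \<Omega> n"
  obtains S where "finite S" "S \<noteq> {}" "S \<subseteq> tuples UNIV n"
    "\<And>f g. f \<in> n_ary Pol_le n \<Longrightarrow> g \<in> n_ary Pol_le n \<Longrightarrow> (\<And>as. as \<in> S \<Longrightarrow> snd f as = snd g as) \<Longrightarrow>
      snd (\<theta> f) ws = snd (\<theta> g) ws"
proof -
  have "\<forall>w\<in>\<Omega>. \<exists>\<rho>. mono \<rho> \<and> finite (range \<rho>) \<and> snd (\<theta> (unary \<rho>)) [w] = w"
    using fixed_by_finite_range by metis
  then obtain \<rho> where \<rho>: "\<And>w. w \<in> \<Omega> \<Longrightarrow> mono (\<rho> w)" "\<And>w. w \<in> \<Omega> \<Longrightarrow> finite (range (\<rho> w))"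
      "\<And>w. w \<in> \<Omega> \<Longrightarrow> snd (\<theta> (unary (\<rho> w))) [w] = w"
    by metis
  have len: "length ws = n" and wsi: "\<And>i. i < n \<Longrightarrow> ws ! i \<in> \<Omega>"
    using ws by (auto simp: tuples_def)
  define S where "S = (\<lambda>as. map (\<lambda>i. \<rho> (ws ! i) (as ! i)) [0..<n]) ` tuples UNIV n"
  define gs where
    "gs = map (\<lambda>i. composition UNIV n (unary (\<rho> (ws ! i))) [projection UNIV n i]) [0..<n]"
  have proj: "[projection UNIV n i] \<in> tuples (n_ary Pol_le n) 1" if "i < n" for i
    using projection_in_n_ary[OF is_clone_Pol_le that] by (simp add: tuples_def)
  have un: "unary (\<rho> (ws ! i)) \<in> n_ary Pol_le 1" if "i < n" for i
    using unary_in_Pol_le \<rho> wsi that by blast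
  have "composition UNIV n (unary (\<rho> (ws ! i))) [projection UNIV n i] \<in> n_ary Pol_le n"
    if "i < n" for i
    using is_clone_Pol_le un[OF that] proj[OF that] by (rule composition_in_n_ary)
  then have gs: "gs \<in> tuples (n_ary Pol_le n) n"
    by (auto simp: gs_def tuples_def)
  have gs_fix: "map (\<lambda>g. snd (\<theta> g) ws) gs = ws"
  proof (rule nth_equalityI)
    fix i assume "i < length (map (\<lambda>g. snd (\<theta> g) ws) gs)"
    then have i: "i < n" by (simp add: gs_def)
    have "snd (\<theta> (projection UNIV n i)) ws = ws ! i"
      using hom i ws by (simp add: clone_hom_def projection_def)
    then show "map (\<lambda>g. snd (\<theta> g) ws) gs ! i = ws ! i"
      using clone_hom_composition_apply[OF hom un[OF i] proj[OF i] ws] \<rho>(3)[OF wsi[OF i]] i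
      by (simp add: gs_def)
  qed (simp add: gs_def len)
  have eval_at_gs: "snd (\<theta> f) ws = snd (\<theta> (composition UNIV n f gs)) ws" if "f \<in> n_ary Pol_le n" for f
    using clone_hom_composition_apply[OF hom that gs ws] gs_fix by simp
  have eval_gs: "map (\<lambda>g. snd g as) gs = map (\<lambda>i. \<rho> (ws ! i) (as ! i)) [0..<n]"
    if "as \<in> tuples UNIV n" for as
    using that by (auto simp: gs_def composition_def unary_def projection_def tuples_def)
  show thesis
  proof (rule that)
    have "S \<subseteq> {as. set as \<subseteq> (\<Union>i<n. range (\<rho> (ws ! i))) \<and> length as = n}"
      unfolding S_def by fastforce
    moreover have "finite (\<Union>i<n. range (\<rho> (ws ! i)))" using \<rho>(2) wsi by auto
    ultimately show "finite S" using finite_lists_length_eq finite_subset by blast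
    have "replicate n 0 \<in> tuples UNIV n" by (simp add: tuples_def)
    then show "S \<noteq> {}" by (auto simp: S_def)
    show "S \<subseteq> tuples UNIV n" by (auto simp: S_def tuples_def)
    fix f g :: "rat operation"
    assume f: "f \<in> n_ary Pol_le n" and g: "g \<in> n_ary Pol_le n"
      and eq: "\<And>as. as \<in> S \<Longrightarrow> snd f as = snd g as"
    have "composition UNIV n f gs = composition UNIV n g gs"
      by (auto simp: composition_def eval_gs S_def intro!: restrict_ext eq)
    with eval_at_gs[OF f] eval_at_gs[OF g] show "snd (\<theta> f) ws = snd (\<theta> g) ws" by simp
  qed
qed

lemma continuous: "continuous_map (clone_topology UNIV Pol_le) (clone_topology \<Omega> P') \<theta>"
proof (rule continuous_map_into_clone_topology)
  show "\<theta> f \<in> P'" if "f \<in> topspace (clone_topology UNIV Pol_le)" for f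
    using that hom_n_ary[of f "fst f"] by (simp add: topspace_clone_topology n_ary_def)
  fix n ws b assume ws: "ws \<in> tuples \<Omega> n" and "b \<in> \<Omega>"
  obtain S where S: "finite S" "S \<noteq> {}" "S \<subseteq> tuples UNIV n" and
    det: "\<And>f g. f \<in> n_ary Pol_le n \<Longrightarrow> g \<in> n_ary Pol_le n \<Longrightarrow>
      (\<And>as. as \<in> S \<Longrightarrow> snd f as = snd g as) \<Longrightarrow> snd (\<theta> f) ws = snd (\<theta> g) ws"
    using value_determined_on_finite_set[OF ws] by metis
  let ?W = "{f \<in> topspace (clone_topology UNIV Pol_le). \<theta> f \<in> n_ary P' n \<and> snd (\<theta> f) ws = b}"
  have W: "?W = {f \<in> n_ary Pol_le n. snd (\<theta> f) ws = b}"
  proof -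
    have "fst f = n" if "f \<in> Pol_le" "\<theta> f \<in> n_ary P' n" for f
      using that hom_n_ary[of f "fst f"] by (simp add: n_ary_def)
    then show ?thesis by (auto simp: topspace_clone_topology hom_n_ary) (simp_all add: n_ary_def)
  qed
  show "openin (clone_topology UNIV Pol_le) ?W"
  proof (subst openin_subopen, intro ballI)
    fix f assume f: "f \<in> ?W"
    let ?N = "\<Inter>as\<in>S. {g \<in> n_ary Pol_le n. snd g as = snd f as}"
    have "openin (clone_topology UNIV Pol_le) ?N"
      using S by (intro openin_INT2 openin_clone_topology_basic) auto
    moreover have "f \<in> ?N" using f W by auto
    moreover have "?N \<subseteq> ?W"
    proof
      fix g assume g: "g \<in> ?N"
      then have "g \<in> n_ary Pol_le n" using S(2) by auto
      then show "g \<in> ?W" using det[of g f] f g unfolding W by auto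
    qed
    ultimately show "\<exists>T. openin (clone_topology UNIV Pol_le) T \<and> f \<in> T \<and> T \<subseteq> ?W" by blast
  qed
qed

text \<open>
  Composing \<open>f\<close> with nullary operations yields the nullary operation of the value, and this relation
  is transported by \<open>\<theta>\<close>. Injectivity of \<open>\<theta>\<close> gives the converse, because a nullary operation on \<open>\<Omega>\<close> is
  determined by its single value.
\<close>

lemma apply_eq_iff:
  assumes f: "f \<in> n_ary Pol_le n" and as: "as \<in> tuples UNIV n"
  shows "snd f as = b \<longleftrightarrow>
    snd (\<theta> f) (map (\<lambda>q. snd (\<theta> (nullary q)) []) as) = snd (\<theta> (nullary b)) []"
proof -
  have nil: "[] \<in> tuples \<Omega> 0" by (simp add: tuples_def)
  have "map nullary as \<in> tuples (n_ary Pol_le 0) n"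
    using as nullary_in_Pol_le by (auto simp: tuples_def)
  note comp = clone_hom_composition_apply[OF hom f this nil]
  have "composition UNIV 0 f (map nullary as) = nullary (snd f as)"
    by (auto simp: composition_def nullary_def tuples_def comp_def fun_eq_iff)
  then have "snd (\<theta> f) (map (\<lambda>q. snd (\<theta> (nullary q)) []) as) = snd (\<theta> (nullary (snd f as))) []"
    using comp by (simp add: comp_def)
  moreover have "p = q" if eq: "snd (\<theta> (nullary p)) [] = snd (\<theta> (nullary q)) []" for p q
  proof -
    have null: "\<theta> (nullary q) = (0, \<lambda>as \<in> tuples \<Omega> 0. snd (\<theta> (nullary q)) [])" for q
    proof -
      have "\<theta> (nullary q) \<in> all_operations \<Omega>" "fst (\<theta> (nullary q)) = 0"
        using hom_n_ary[OF nullary_in_Pol_le[of q]] clone by (auto simp: n_ary_def is_clone_def)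
      then show ?thesis
        by (cases "\<theta> (nullary q)") (auto simp: all_operations_def fun_eq_iff tuples_def PiE_iff extensional_def)
    qed
    have "\<theta> (nullary p) = \<theta> (nullary q)" using null[of p] null[of q] eq by simp
    moreover have "inj_on \<theta> Pol_le" using iso by (simp add: clone_iso_def bij_betw_def)
    ultimately have "nullary p = nullary q"
      using nullary_in_Pol_le by (auto simp: n_ary_def dest: inj_onD)
    then have "snd (nullary p) [] = snd (nullary q) []" by simp
    then show ?thesis by (simp add: nullary_def tuples_def)
  qed
  ultimately show ?thesis by metis
qed

lemma continuous_inverse:
  "continuous_map (clone_topology \<Omega> P') (clone_topology UNIV Pol_le) (inv_into Pol_le \<theta>)"
proof (rule continuous_map_into_clone_topology)
  have bij: "bij_betw \<theta> Pol_le P'" using iso by (simp add: clone_iso_def)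
  show inv: "inv_into Pol_le \<theta> g \<in> Pol_le" if "g \<in> topspace (clone_topology \<Omega> P')" for g
    using that bij by (metis bij_betw_imp_surj_on inv_into_into topspace_clone_topology)
  fix n and as :: "rat list" and b assume as: "as \<in> tuples UNIV n"
  define e where "e q = snd (\<theta> (nullary q)) []" for q
  have e: "e q \<in> \<Omega>" for q
    unfolding e_def
    by (rule n_ary_apply_closed[OF clone hom_n_ary[OF nullary_in_Pol_le]]) (simp add: tuples_def)
  have arity: "f \<in> n_ary Pol_le n \<longleftrightarrow> \<theta> f \<in> n_ary P' n" if "f \<in> Pol_le" for f
    using that hom_n_ary[of f "fst f"] by (auto simp: n_ary_def)
  have "{g \<in> P'. inv_into Pol_le \<theta> g \<in> n_ary Pol_le n \<and> snd (inv_into Pol_le \<theta> g) as = b}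
      = {g \<in> n_ary P' n. snd g (map e as) = e b}"
  proof (intro set_eqI)
    fix g
    have "inv_into Pol_le \<theta> g \<in> Pol_le" "\<theta> (inv_into Pol_le \<theta> g) = g" if "g \<in> P'"
      using that inv bij by (auto simp: topspace_clone_topology bij_betw_inv_into_right)
    then show "g \<in> {g \<in> P'. inv_into Pol_le \<theta> g \<in> n_ary Pol_le n \<and> snd (inv_into Pol_le \<theta> g) as = b}
      \<longleftrightarrow> g \<in> {g \<in> n_ary P' n. snd g (map e as) = e b}"
      using arity[of "inv_into Pol_le \<theta> g"] apply_eq_iff[of "inv_into Pol_le \<theta> g" n as b] as
      unfolding e_def[abs_def] by (cases "g \<in> P'") (auto simp: n_ary_def)
  qed
  moreover have "map e as \<in> tuples \<Omega> n" using as e by (auto simp: tuples_def)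
  ultimately show "openin (clone_topology \<Omega> P')
    {g \<in> topspace (clone_topology \<Omega> P').
      inv_into Pol_le \<theta> g \<in> n_ary Pol_le n \<and> snd (inv_into Pol_le \<theta> g) as = b}"
    using openin_clone_topology_basic[OF _ e] by (simp add: topspace_clone_topology)
qed

end

theorem theorem5p2:
  fixes \<Omega> :: "'b set" and P' :: "'b operation set"
    and \<theta> :: "rat operation \<Rightarrow> 'b operation"
  assumes "countable \<Omega>"
    and "is_clone \<Omega> P'"
    and "closedin (clone_topology \<Omega> (all_operations \<Omega>)) P'"
    and "clone_iso UNIV (Pol_le :: rat operation set) \<Omega> P' \<theta>"
  shows "homeomorphic_map (clone_topology UNIV (Pol_le :: rat operation set))
           (clone_topology \<Omega> P') \<theta>"
proof -
  have bij: "bij_betw \<theta> Pol_le P'" using assms(4) by (simp add: clone_iso_def)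
  have "homeomorphic_maps (clone_topology UNIV Pol_le) (clone_topology \<Omega> P') \<theta> (inv_into Pol_le \<theta>)"
    unfolding homeomorphic_maps_def
    using continuous[OF assms(1,2,4)] continuous_inverse[OF assms(1,2,4)] bij
    by (auto simp: topspace_clone_topology bij_betw_inv_into_left bij_betw_inv_into_right)
  then show ?thesis by (auto simp: homeomorphic_map_maps)
qed

end
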